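(* Let $F_i\colon \mathbb{R}^n\rightrightarrows \mathbb{R}^p$ for $i=1,\ldots,m$ be nearly convex set-valued mappings, and let $F=\bigcap_{i=1}^m F_i$. Assume that $$\bigcap_{i=1}^m \mathrm{ri}(\mathrm{gph}\, F_i) \neq \emptyset.$$ Then for any $(\bar x,\bar y)\in\mathrm{gph}\,F$ and any $y^*\in\mathbb{R}^p$ we have $$D^*F(\bar x,\bar y)(y^* )=\bigcup\big\{D^*F_1(\bar x,\bar y)(y_1^* )+\cdots+D^*F_m(\bar x,\bar y)(y_m^* )\;\big|\; y_1^*,\ldots,y_m^*\in\mathbb{R}^p,\ y^*=y_1^*+\cdots+y_m^*\big\}.$$
   Context: A set $\Omega\subset\mathbb{R}^k$ is nearly convex if there exists a convex set $C\subset\mathbb{R}^k$ such that $C\subset\Omega\subset\overline{C}$, where $\overline{C}$ is the closure of $C$. For an arbitrary set $\Omega\subset\mathbb{R}^k$, the relative interior is $\mathrm{ri}\,\Omega=\{a\in\Omega \mid \text{there exists } \delta>0 \text{ with } B(a;\delta)\cap \mathrm{aff}\,\Omega\subset\Omega\}$, where $\mathrm{aff}\,\Omega$ is the affine hull and $B(a;\delta)$ the open ball. A set-valued mapping $F\colon\mathbb{R}^n\rightrightarrows\mathbb{R}^p$ assigns to each $x\in\mathbb{R}^n$ a (possibly empty) subset $F(x)\subset\mathbb{R}^p$, and $\mathrm{gph}\,F=\{(x,y)\in\mathbb{R}^n\times\mathbb{R}^p\mid y\in F(x)\}$. $F$ is nearly convex if $\mathrm{gph}\,F$ is a nearly convex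 set. The intersection mapping is $\big(\bigcap_{i=1}^m F_i\big)(x)=F_1(x)\cap\cdots\cap F_m(x)$; under the stated hypotheses it is nearly convex. The normal cone to a nearly convex set $\Omega\subset\mathbb{R}^k$ at $\bar z\in\Omega$ is $N(\bar z;\Omega)=\{w\in\mathbb{R}^k\mid \langle w,z-\bar z\rangle\le 0 \text{ for all } z\in\Omega\}$. The coderivative of a nearly convex set-valued mapping $F$ at $(\bar x,\bar y)\in\mathrm{gph}\,F$ is the set-valued mapping $D^*F(\bar x,\bar y)\colon\mathbb{R}^p\rightrightarrows\mathbb{R}^n$ given by $D^*F(\bar x,\bar y)(v)=\{u\in\mathbb{R}^n\mid (u,-v)\in N((\bar x,\bar y);\mathrm{gph}\,F)\}$. Sums of sets are Minkowski sums. *)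

theory Defs
  imports "HOL-Analysis.Analysis"
begin

definition nearly_convex :: "'a::euclidean_space set \<Rightarrow> bool" where
  "nearly_convex \<Omega> \<longleftrightarrow> (\<exists>C. convex C \<and> C \<subseteq> \<Omega> \<and> \<Omega> \<subseteq> closure C)"

definition gph :: "('a \<Rightarrow> 'b set) \<Rightarrow> ('a \<times> 'b) set" where
  "gph F = {(x, y). y \<in> F x}"

definition nearly_convex_map ::
    "('a::euclidean_space \<Rightarrow> 'b::euclidean_space set) \<Rightarrow> bool" where
  "nearly_convex_map F \<longleftrightarrow> nearly_convex (gph F)"

definition Inter_map :: "'i set \<Rightarrow> ('i \<Rightarrow> 'a \<Rightarrow> 'b set) \<Rightarrow> 'a \<Rightarrow> 'b set" where
  "Inter_map I F x = (\<Inter>i\<in>I. F i x)"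

(* Intended for nearly convex \<Omega> and z \<in> \<Omega>; the formula is simply totalised elsewhere. *)
definition normal_cone :: "'a::euclidean_space \<Rightarrow> 'a set \<Rightarrow> 'a set" where
  "normal_cone z \<Omega> = {w. \<forall>z'\<in>\<Omega>. inner w (z' - z) \<le> 0}"

(* Intended for nearly convex F and (x, y) \<in> gph F. *)
definition coderivative ::
    "('a::euclidean_space \<Rightarrow> 'b::euclidean_space set) \<Rightarrow> 'a \<times> 'b \<Rightarrow> 'b \<Rightarrow> 'a set" where
  "coderivative F z v = {u. (u, - v) \<in> normal_cone z (gph F)}"

end

theory Submission
  imports Defs
begin

text \<open>
  Up to closure, which normal cones do not see, every graph is convex, so the theorem reduces to
  the intersection rule \<open>N(z; \<Inter>A\<^sub>i) = \<Sum>N(z; A\<^sub>i)\<close> for convex sets whose relative interiors meet.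
  For two sets, \<open>w \<in> N(z; A \<inter> B)\<close> means that the convex set of all \<open>(a - b, t)\<close> with
  \<open>t < w \<bullet> (a - z)\<close> omits the origin. A functional \<open>(u, s)\<close> separating it from the origin has
  \<open>s < 0\<close>, because a common relative interior point would otherwise make it vanish on the set.
  Scaled to \<open>s = -1\<close>, it gives the decomposition \<open>w = (w - u) + u\<close>.
\<close>

section \<open>Normal cones and closures\<close>

lemma normal_cone_antimono: "A \<subseteq> B \<Longrightarrow> normal_cone z B \<subseteq> normal_cone z A"
  unfolding normal_cone_def by blast

text \<open>Base case of the later induction: the empty intersection is \<open>UNIV\<close>, the
  empty sum of sets is \<open>{0}\<close>. Testing at \<open>z + w\<close> bounds the squared norm
  of \<open>w\<close> by 0.\<close>

lemma normal_cone_UNIV: "normal_cone z UNIV = {0}"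
proof -
  have "w = 0" if "w \<in> normal_cone z UNIV" for w
  proof -
    have "w \<bullet> ((z + w) - z) \<le> 0"
      using that unfolding normal_cone_def by blast
    then show "w = 0" using inner_ge_zero[of w] by (simp add: order_antisym)
  qed
  then show ?thesis unfolding normal_cone_def by auto
qed

text \<open>A normal vector confines \<open>A\<close> to a closed half-space, which then also
  contains the closure.\<close>

lemma normal_cone_closure: "normal_cone z (closure A) = normal_cone z A"
proof
  show "normal_cone z A \<subseteq> normal_cone z (closure A)"
  proof
    fix w assume "w \<in> normal_cone z A"
    then have "A \<subseteq> {x. w \<bullet> x \<le> w \<bullet> z}"
      unfolding normal_cone_def by (auto simp: inner_diff_right)
    then have "closure A \<subseteq> {x. w \<bullet> x \<le> w \<bullet> z}"
      by (intro closure_minimal closed_halfspace_le)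
    then show "w \<in> normal_cone z (closure A)"
      unfolding normal_cone_def by (auto simp: inner_diff_right)
  qed
qed (simp add: normal_cone_antimono closure_subset)

lemma normal_cone_eq_of_dense:
  assumes "C \<subseteq> A" "A \<subseteq> closure C"
  shows "normal_cone z A = normal_cone z C"
  using normal_cone_antimono[OF assms(1)] normal_cone_antimono[OF assms(2)]
  by (auto simp: normal_cone_closure)

section \<open>Relative interiors\<close>

text \<open>\<open>A\<close> and \<open>closure C\<close> have the same affine hull, so relative
  interiors are monotone between them; a convex set and its closure share their relative
  interior.\<close>

lemma rel_interior_subset_of_dense:
  fixes A C :: "'a::euclidean_space set"
  assumes "convex C" "C \<subseteq> A" "A \<subseteq> closure C"
  shows "rel_interior A \<subseteq> rel_interior C"
proof -
  have "affine hull A = affine hull (closure C)"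
    using hull_mono[OF assms(2), of affine] hull_mono[OF assms(3), of affine]
    by (simp add: subset_antisym)
  then show ?thesis
    using subset_rel_interior[OF assms(3)] convex_rel_interior_closure[OF assms(1)] by simp
qed

text \<open>The segment from \<open>a\<close> to \<open>c\<close> can be prolonged beyond
  \<open>c\<close> inside \<open>A\<close>; a smaller value at \<open>a\<close> would force a value
  beyond \<open>c\<close> above the maximum.\<close>

lemma linear_functional_max_rel_interior_const:
  fixes A :: "'a::euclidean_space set"
  assumes "convex A" "c \<in> rel_interior A" and max: "\<And>x. x \<in> A \<Longrightarrow> u \<bullet> x \<le> u \<bullet> c" and "a \<in> A"
  shows "u \<bullet> a = u \<bullet> c"
proof -
  obtain e where e: "e > 1" "(1 - e) *\<^sub>R a + e *\<^sub>R c \<in> A"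
    using convex_rel_interior_iff[OF assms(1), of c] assms(2,4) by blast
  have "(1 - e) * (u \<bullet> a) + e * (u \<bullet> c) \<le> u \<bullet> c"
    using max[OF e(2)] by (simp add: inner_add_right)
  then have "(e - 1) * (u \<bullet> c) \<le> (e - 1) * (u \<bullet> a)" by (simp add: algebra_simps)
  then have "u \<bullet> c \<le> u \<bullet> a" using e(1) by simp
  with max[OF assms(4)] show ?thesis by simp
qed

section \<open>The intersection rule for two convex sets\<close>

text \<open>The base point is only taken in the closures, because a point of a nearly convex set may
  lie outside the convex set that is dense in it.\<close>

lemma normal_cone_Int_subset:
  fixes A B :: "'a::euclidean_space set"
  assumes A: "convex A" and B: "convex B"
    and ri: "rel_interior A \<inter> rel_interior B \<noteq> {}"
    and z: "z \<in> closure A" "z \<in> closure B"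
  shows "normal_cone z (A \<inter> B) \<subseteq> normal_cone z A + normal_cone z B"
proof
  fix w assume w: "w \<in> normal_cone z (A \<inter> B)"
  obtain c where cri: "c \<in> rel_interior A" "c \<in> rel_interior B" using ri by blast
  then have c: "c \<in> A" "c \<in> B" using rel_interior_subset by blast+
  \<comment> \<open>The first component vanishes exactly at common points. The inequality is strict
    so that common points with \<open>w \<bullet> (a - z) = 0\<close> do not put the origin into
    \<open>S\<close>.\<close>
  define S where "S = {(a - b, t) | a b t. a \<in> A \<and> b \<in> B \<and> t < w \<bullet> (a - z)}"
  have SI: "(a - b, t) \<in> S" if "a \<in> A" "b \<in> B" "t < w \<bullet> (a - z)" for a b t
    unfolding S_def using that by blast
  have "convex S"
  proof (rule convexI)
    fix p q :: "'a \<times> real" and \<alpha> \<beta> :: real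
    assume "p \<in> S" "q \<in> S" and l: "0 \<le> \<alpha>" "0 \<le> \<beta>" "\<alpha> + \<beta> = 1"
    then obtain a b t a' b' t' where
      p: "p = (a - b, t)" "a \<in> A" "b \<in> B" "t < w \<bullet> (a - z)" and
      q: "q = (a' - b', t')" "a' \<in> A" "b' \<in> B" "t' < w \<bullet> (a' - z)"
      unfolding S_def by blast
    let ?a = "\<alpha> *\<^sub>R a + \<beta> *\<^sub>R a'" and ?b = "\<alpha> *\<^sub>R b + \<beta> *\<^sub>R b'"
    have "?a - z = \<alpha> *\<^sub>R (a - z) + \<beta> *\<^sub>R (a' - z)"
      using l(3) by (simp add: algebra_simps flip: scaleR_add_left)
    then have "w \<bullet> (?a - z) = \<alpha> * (w \<bullet> (a - z)) + \<beta> * (w \<bullet> (a' - z))"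
      by (simp add: inner_add_right)
    moreover have "\<alpha> * t + \<beta> * t' < \<alpha> * (w \<bullet> (a - z)) + \<beta> * (w \<bullet> (a' - z))"
    \<comment> \<open>Strictness survives only under a positive weight; if \<alpha> = 0 then \<beta>
      = 1 and the second inequality supplies it.\<close>
    proof (cases "\<alpha> = 0")
      case False
      then have "\<alpha> * t < \<alpha> * (w \<bullet> (a - z))" using p(4) l(1) by simp
      moreover have "\<beta> * t' \<le> \<beta> * (w \<bullet> (a' - z))" using q(4) l(2) by (simp add: mult_left_mono)
      ultimately show ?thesis by simp
    qed (use l q(4) in simp)
    ultimately have "(?a - ?b, \<alpha> * t + \<beta> * t') \<in> S"
      using p q l A B by (intro SI) (auto intro: convexD)
    then show "\<alpha> *\<^sub>R p + \<beta> *\<^sub>R q \<in> S"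
      unfolding p(1) q(1) by (simp add: algebra_simps)
  qed
  moreover have "S \<noteq> {}" using SI[OF c, of "w \<bullet> (c - z) - 1"] by auto
  moreover have "0 \<notin> S"
  proof
    assume "0 \<in> S"
    then obtain a where "a \<in> A" "a \<in> B" "0 < w \<bullet> (a - z)"
      unfolding S_def zero_prod_def by auto
    moreover have "w \<bullet> (a - z) \<le> 0" if "a \<in> A \<inter> B"
      using w that unfolding normal_cone_def by blast
    ultimately show False by simp
  qed
  \<comment> \<open>\<open>S\<close> may lie in a proper subspace; choosing \<open>v\<close> in its
    span keeps \<open>v\<close> from being orthogonal to all of \<open>S\<close>.\<close>
  ultimately obtain v where v: "v \<in> span S" "v \<noteq> 0" "\<And>x. x \<in> S \<Longrightarrow> 0 \<le> v \<bullet> x"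
    by (rule separating_hyperplane_set_0_inspan[of S]) (rule that)
  obtain u s where us: "v = (u, s)" by (cases v)
  have sep: "0 \<le> u \<bullet> (a - b) + s * t" if "a \<in> A" "b \<in> B" "t < w \<bullet> (a - z)" for a b t
    using v(3)[OF SI[OF that]] by (simp add: us)
  \<comment> \<open>Taking \<open>a = b = c\<close> removes \<open>u\<close> and isolates the sign
    of \<open>s\<close>: \<open>t\<close> may be arbitrarily negative.\<close>
  have sep0: "0 \<le> s * t" if "t < w \<bullet> (c - z)" for t
    using sep[OF c that] by simp
  have "s \<le> 0"
  proof (rule ccontr)
    assume "\<not> s \<le> 0"
    moreover have "0 \<le> s * (min 0 (w \<bullet> (c - z)) - 1)" by (rule sep0) auto
    ultimately show False by (simp add: zero_le_mult_iff)
  qed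
  \<comment> \<open>If \<open>s = 0\<close>, then \<open>u\<close> separates \<open>A\<close> from
    \<open>B\<close> weakly, so \<open>c\<close> minimises \<open>u\<close> on \<open>A\<close> and
    maximises it on \<open>B\<close>. Being in both relative interiors, it makes \<open>u\<close>
    constant with the same value on both sets, so \<open>v\<close> is orthogonal to \<open>S\<close>
    and hence to itself.\<close>
  moreover have "s \<noteq> 0"
  proof
    assume s: "s = 0"
    have le: "u \<bullet> b \<le> u \<bullet> a" if "a \<in> A" "b \<in> B" for a b
      using sep[OF that, of "w \<bullet> (a - z) - 1"] s by (simp add: inner_diff_right)
    have "u \<bullet> b = u \<bullet> c" if "b \<in> B" for b
      using linear_functional_max_rel_interior_const[OF B cri(2) le[OF c(1)] that] .
    moreover have "(- u) \<bullet> a = (- u) \<bullet> c" if "a \<in> A" for a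
      by (rule linear_functional_max_rel_interior_const[OF A cri(1) _ that]) (simp add: le c)
    ultimately have "S \<subseteq> {x. orthogonal v x}"
      unfolding S_def us by (auto simp: orthogonal_def s inner_diff_right)
    then have "orthogonal v v"
      using v(1) orthogonal_to_span[of v S v] by blast
    then show False using v(2) by (simp add: orthogonal_self)
  qed
  ultimately have s: "s < 0" by simp
  \<comment> \<open>Dividing by \<open>- s > 0\<close> normalises the functional to
    \<open>(y, -1)\<close>; \<open>y\<close> will be the part of \<open>w\<close> normal to
    \<open>B\<close>.\<close>
  define y where "y = (1 / - s) *\<^sub>R u"
  have uy: "u = (- s) *\<^sub>R y" using s by (simp add: y_def)
  \<comment> \<open>Letting \<open>t\<close> rise to its bound turns the strict constraint into a
    weak inequality.\<close>
  have key: "w \<bullet> (a - z) \<le> y \<bullet> (a - b)" if "a \<in> A" "b \<in> B" for a b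
  proof (rule dense_le)
    fix r assume "r < w \<bullet> (a - z)"
    from sep[OF that this] have "0 \<le> (- s) * (y \<bullet> (a - b) - r)"
      by (simp add: uy algebra_simps)
    then show "r \<le> y \<bullet> (a - b)" using s by (simp add: mult_le_0_iff)
  qed
  \<comment> \<open>With \<open>a\<close> fixed, \<open>key\<close> is a closed half-space condition
    on \<open>b\<close>, so it extends to \<open>b = z\<close>. The bound for \<open>B\<close>
    follows in the same way with \<open>b\<close> fixed and \<open>a = z\<close>.\<close>
  have "w \<bullet> (a - z) \<le> y \<bullet> (a - z)" if "a \<in> A" for a
  proof -
    have "closure B \<subseteq> {b. y \<bullet> b \<le> y \<bullet> a - w \<bullet> (a - z)}"
    proof (intro closure_minimal closed_halfspace_le subsetI CollectI)
      fix b assume "b \<in> B"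
      from key[OF that this] show "y \<bullet> b \<le> y \<bullet> a - w \<bullet> (a - z)"
        by (simp add: inner_diff_right)
    qed
    then have "y \<bullet> z \<le> y \<bullet> a - w \<bullet> (a - z)" using z(2) by blast
    then show ?thesis by (simp add: inner_diff_right)
  qed
  then have "w - y \<in> normal_cone z A"
    unfolding normal_cone_def by (simp add: inner_diff_left)
  moreover have "y \<bullet> (b - z) \<le> 0" if "b \<in> B" for b
  proof -
    have "closure A \<subseteq> {a. (w - y) \<bullet> a \<le> w \<bullet> z - y \<bullet> b}"
    proof (intro closure_minimal closed_halfspace_le subsetI CollectI)
      fix a assume "a \<in> A"
      from key[OF this that] show "(w - y) \<bullet> a \<le> w \<bullet> z - y \<bullet> b"
        by (simp add: inner_diff_right inner_diff_left)
    qed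
    then have "(w - y) \<bullet> z \<le> w \<bullet> z - y \<bullet> b" using z(1) by blast
    then show ?thesis by (simp add: inner_diff_right inner_diff_left)
  qed
  then have "y \<in> normal_cone z B"
    unfolding normal_cone_def by simp
  ultimately have "w - y + y \<in> normal_cone z A + normal_cone z B"
    by (rule set_plus_intro)
  then show "w \<in> normal_cone z A + normal_cone z B" by simp
qed

section \<open>The intersection rule for finite families\<close>

lemma normal_cone_INT_convex_subset:
  fixes C :: "'i \<Rightarrow> 'a::euclidean_space set"
  assumes "finite I" "\<And>i. i \<in> I \<Longrightarrow> convex (C i)"
    and "c \<in> (\<Inter>i\<in>I. rel_interior (C i))" "z \<in> (\<Inter>i\<in>I. closure (C i))"
  shows "normal_cone z (\<Inter>i\<in>I. C i) \<subseteq> (\<Sum>i\<in>I. normal_cone z (C i))"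
  using assms
proof (induction I)
  case empty
  then show ?case by (simp add: normal_cone_UNIV)
next
  case (insert j I)
  let ?D = "\<Inter>i\<in>I. C i"
  have conv: "\<And>S. S \<in> C ` I \<Longrightarrow> convex S" using insert.prems(1) by blast
  have c: "c \<in> \<Inter> (rel_interior ` C ` I)" using insert.prems(2) by auto
  then have ne: "\<Inter> (rel_interior ` C ` I) \<noteq> {}" by blast
  \<comment> \<open>The common point \<open>c\<close> lets relative interior and closure pass
    through the intersection, which places \<open>c\<close> and \<open>z\<close> as the two-set rule
    requires for \<open>C j\<close> and \<open>?D\<close>.\<close>
  have "rel_interior ?D = \<Inter> (rel_interior ` C ` I)"
    using convex_rel_interior_finite_Inter[OF conv ne] insert.hyps(1) by simp
  then have cD: "c \<in> rel_interior ?D" using c by simp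
  have "closure ?D = \<Inter> (closure ` C ` I)"
    using closure_Inter_convex[OF conv ne] .
  then have zD: "z \<in> closure ?D" using insert.prems(3) by simp
  have ri: "rel_interior (C j) \<inter> rel_interior ?D \<noteq> {}"
    using insert.prems(2) cD by blast
  have IH: "normal_cone z ?D \<subseteq> (\<Sum>i\<in>I. normal_cone z (C i))"
    by (rule insert.IH) (use insert.prems in simp_all)
  have "normal_cone z (C j \<inter> ?D) \<subseteq> normal_cone z (C j) + normal_cone z ?D"
  proof (rule normal_cone_Int_subset[OF _ _ ri _ zD])
    show "convex (C j)" "z \<in> closure (C j)" using insert.prems by simp_all
    show "convex ?D" by (rule convex_INT) (simp add: insert.prems(1))
  qed
  also have "\<dots> \<subseteq> normal_cone z (C j) + (\<Sum>i\<in>I. normal_cone z (C i))"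
    by (rule set_plus_mono2[OF subset_refl IH])
  finally show ?case using insert.hyps by simp
qed

text \<open>For the forward inclusion, shrinking each set to a dense convex \<open>C i\<close>
  enlarges the cone of the intersection and leaves each single cone unchanged. The reverse inclusion
  adds up the defining inequalities.\<close>

lemma normal_cone_INT_nearly_convex:
  fixes \<Omega> :: "'i \<Rightarrow> 'a::euclidean_space set"
  assumes I: "finite I" and nc: "\<And>i. i \<in> I \<Longrightarrow> nearly_convex (\<Omega> i)"
    and ri: "(\<Inter>i\<in>I. rel_interior (\<Omega> i)) \<noteq> {}" and z: "z \<in> (\<Inter>i\<in>I. \<Omega> i)"
  shows "normal_cone z (\<Inter>i\<in>I. \<Omega> i) = (\<Sum>i\<in>I. normal_cone z (\<Omega> i))"
proof
  obtain C where C: "\<And>i. i \<in> I \<Longrightarrow> convex (C i) \<and> C i \<subseteq> \<Omega> i \<and> \<Omega> i \<subseteq> closure (C i)"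
    using nc unfolding nearly_convex_def by metis
  obtain c where c: "c \<in> (\<Inter>i\<in>I. rel_interior (\<Omega> i))" using ri by blast
  have "normal_cone z (\<Inter>i\<in>I. \<Omega> i) \<subseteq> normal_cone z (\<Inter>i\<in>I. C i)"
    by (rule normal_cone_antimono, rule INF_superset_mono) (use C in simp_all)
  also have "\<dots> \<subseteq> (\<Sum>i\<in>I. normal_cone z (C i))"
  proof (rule normal_cone_INT_convex_subset[OF I])
    show "convex (C i)" if "i \<in> I" for i using C[OF that] by simp
    show "c \<in> (\<Inter>i\<in>I. rel_interior (C i))"
    proof
      fix i assume i: "i \<in> I"
      with c have "c \<in> rel_interior (\<Omega> i)" by blast
      then show "c \<in> rel_interior (C i)"
        using rel_interior_subset_of_dense[of "C i" "\<Omega> i"] C[OF i] by blast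
    qed
    show "z \<in> (\<Inter>i\<in>I. closure (C i))"
    proof
      fix i assume i: "i \<in> I"
      with z have "z \<in> \<Omega> i" by blast
      then show "z \<in> closure (C i)" using C[OF i] by blast
    qed
  qed
  also have "\<dots> = (\<Sum>i\<in>I. normal_cone z (\<Omega> i))"
  proof (rule sum.cong[OF refl])
    fix i assume "i \<in> I"
    then show "normal_cone z (C i) = normal_cone z (\<Omega> i)"
      using C normal_cone_eq_of_dense[of "C i" "\<Omega> i" z] by simp
  qed
  finally show "normal_cone z (\<Inter>i\<in>I. \<Omega> i) \<subseteq> (\<Sum>i\<in>I. normal_cone z (\<Omega> i))" .
  show "(\<Sum>i\<in>I. normal_cone z (\<Omega> i)) \<subseteq> normal_cone z (\<Inter>i\<in>I. \<Omega> i)"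
  proof
    fix w assume "w \<in> (\<Sum>i\<in>I. normal_cone z (\<Omega> i))"
    then obtain v where w: "w = sum v I" and v: "\<forall>i\<in>I. v i \<in> normal_cone z (\<Omega> i)"
      unfolding set_sum_alt[OF I] by blast
    have "w \<bullet> (x - z) \<le> 0" if "x \<in> (\<Inter>i\<in>I. \<Omega> i)" for x
      unfolding w inner_sum_left using v that
      by (intro sum_nonpos) (auto simp: normal_cone_def)
    then show "w \<in> normal_cone z (\<Inter>i\<in>I. \<Omega> i)" unfolding normal_cone_def by blast
  qed
qed

section \<open>Coderivatives of intersection mappings\<close>

lemma gph_Inter_map: "gph (Inter_map I F) = (\<Inter>i\<in>I. gph (F i))"
  unfolding gph_def Inter_map_def by auto

theorem theorem5p9:
  fixes F :: "nat \<Rightarrow> real ^ 'n \<Rightarrow> (real ^ 'p) set" and m :: nat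
    and xbar :: "real ^ 'n" and ybar ystar :: "real ^ 'p"
  assumes "m \<ge> 1"
    and "\<And>i. i \<in> {1..m} \<Longrightarrow> nearly_convex_map (F i)"
    and "(\<Inter>i\<in>{1..m}. rel_interior (gph (F i))) \<noteq> {}"
    and "(xbar, ybar) \<in> gph (Inter_map {1..m} F)"
  shows "coderivative (Inter_map {1..m} F) (xbar, ybar) ystar =
    \<Union> {(\<Sum>i\<in>{1..m}. coderivative (F i) (xbar, ybar) (y i)) | y :: nat \<Rightarrow> real ^ 'p.
        ystar = (\<Sum>i\<in>{1..m}. y i)}"
proof -
  let ?I = "{1..m}" and ?z = "(xbar, ybar)"
  \<comment> \<open>The graph of the intersection mapping is the intersection of the graphs, so the
    rule applies in the product space.\<close>
  have N: "normal_cone ?z (gph (Inter_map ?I F)) = (\<Sum>i\<in>?I. normal_cone ?z (gph (F i)))"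
    unfolding gph_Inter_map
    using assms(2-4) by (intro normal_cone_INT_nearly_convex)
      (auto simp: nearly_convex_map_def gph_Inter_map)
  have "u \<in> coderivative (Inter_map ?I F) ?z ystar \<longleftrightarrow>
      (\<exists>y. ystar = sum y ?I \<and> u \<in> (\<Sum>i\<in>?I. coderivative (F i) ?z (y i)))" for u
  proof
    assume "u \<in> coderivative (Inter_map ?I F) ?z ystar"
    then have "(u, - ystar) \<in> (\<Sum>i\<in>?I. normal_cone ?z (gph (F i)))"
      unfolding coderivative_def N by blast
    then obtain v where v: "(u, - ystar) = sum v ?I"
        "\<forall>i\<in>?I. v i \<in> normal_cone ?z (gph (F i))"
      unfolding set_sum_alt[OF finite_atLeastAtMost] by blast
    \<comment> \<open>The coderivative pairs \<open>u\<close> with the negated argument, so each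
      \<open>y i\<close> is the negated second component of a normal vector.\<close>
    define y where "y = (\<lambda>i. - snd (v i))"
    have "u = (\<Sum>i\<in>?I. fst (v i))" "- ystar = (\<Sum>i\<in>?I. snd (v i))"
      using arg_cong[OF v(1), of fst] arg_cong[OF v(1), of snd] by (simp_all add: fst_sum snd_sum)
    moreover from this(2) have "ystar = sum y ?I"
      unfolding y_def sum_negf by (metis minus_minus)
    moreover have "\<forall>i\<in>?I. fst (v i) \<in> coderivative (F i) ?z (y i)"
      using v(2) by (simp add: coderivative_def y_def)
    ultimately show "\<exists>y. ystar = sum y ?I \<and> u \<in> (\<Sum>i\<in>?I. coderivative (F i) ?z (y i))"
      unfolding set_sum_alt[OF finite_atLeastAtMost] by blast
  next
    assume "\<exists>y. ystar = sum y ?I \<and> u \<in> (\<Sum>i\<in>?I. coderivative (F i) ?z (y i))"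
    then obtain y x where yx: "ystar = sum y ?I" "u = sum x ?I"
        "\<forall>i\<in>?I. x i \<in> coderivative (F i) ?z (y i)"
      unfolding set_sum_alt[OF finite_atLeastAtMost] by blast
    \<comment> \<open>Conversely, pairing the two decompositions with the same sign change gives a
      sum of normals to the graphs.\<close>
    have "(u, - ystar) = (\<Sum>i\<in>?I. (x i, - y i))"
      unfolding sum_prod yx by (simp add: sum_negf)
    moreover have "\<forall>i\<in>?I. (x i, - y i) \<in> normal_cone ?z (gph (F i))"
      using yx(3) by (simp add: coderivative_def)
    ultimately have "(u, - ystar) \<in> (\<Sum>i\<in>?I. normal_cone ?z (gph (F i)))"
      unfolding set_sum_alt[OF finite_atLeastAtMost] mem_Collect_eq
      by (intro exI[of _ "\<lambda>i. (x i, - y i)"] conjI)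
    then show "u \<in> coderivative (Inter_map ?I F) ?z ystar"
      unfolding coderivative_def N by blast
  qed
  then show ?thesis by blast
qed

end
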